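(* Let $(X,\|\cdot\|)$ be a real Banach space with dual $(X^*,\|\cdot\|_* )$. Suppose that $X$ has the component-* property, and denote by $(e_k)_{k\in\mathbb N}$ and $(f_j)_{j\in\mathbb N}$ (or $(e_k)_{k=1}^n$ and $(f_j)_{j=1}^n$ when $\dim X=n\in\mathbb N$) the corresponding Schauder bases of $X$ and $X^*$, respectively. Given a nonempty subset $U\subseteq X$, suppose that a function $h:U\to X^*$, written as $h(x)=\sum_{j=1}^\infty h_j(x)f_j$, $x\in U$ (a sum from $1$ to $n$ when $\dim X=n$), maps every bounded sequence in $U$ to a bounded sequence in $X^*$. Suppose also that for each $j$ the $j$-th coordinate function $h_j:U\to\mathbb R$ depends continuously on finitely many components. Then $h$ is weak-to-weak$^*$ sequentially continuous on $U$.
   Context: A Schauder basis of a real infinite-dimensional Banach space $X$ is a sequence $(e_k)$ in $X$ such that each $x\in X$ has a unique representation $x=\sum_{k=1}^\infty x(k)e_k$ with real coordinates $x(k)$; an algebraic basis of a finite-dimensional space is also regarded as a Schauder basis. A sequence $(x_i)$ in a space with a given Schauder basis converges component-wise if $\lim_{i\to\infty}x_i(k)$ exists in $\mathbb R$ for each $k$. $X$ has the component-* property if both $X$ and $X^*$ have Schauder bases, and each sequence in $X^*$ which is bounded and converges component-wise (with respect to the given Schauder basis of $X^*$) also converges in the weak$^*$ topology. A function $g:U\to\mathbb R$, $\emptyset\ne U\subseteq X$, depends continuously on finitely many components if there are a nonempty finite set of indices $I\subset\mathbb N$ and a continuous function $\tilde g:\Pi(U)\to\mathbb R$ with $g(x)=\tilde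 g(\Pi(x))$ for all $x\in U$, where $\Pi:X\to X$, $\Pi(x):=\sum_{k\in I}x(k)e_k$, and $\Pi(U)$ carries the norm of $X$. $h:U\to X^*$ is weak-to-weak$^*$ sequentially continuous on $U$ if whenever a sequence $x_i\in U$ converges weakly to $x\in U$, $\langle h(x_i),z\rangle\to\langle h(x),z\rangle$ for all $z\in X$. *)

theory Defs
  imports "HOL-Analysis.Analysis"
begin

definition finite_dim :: "'a::real_vector itself \<Rightarrow> bool" where
  "finite_dim _ \<longleftrightarrow> (\<exists>B :: 'a set. finite B \<and> span B = UNIV)"

text \<open>Indices start at 0: the index set of a Schauder basis is \<open>{0, ..., n - 1}\<close> if the space has
  finite dimension \<open>n\<close>, and all of \<open>nat\<close> otherwise. In the finite-dimensional case the members
  \<open>e k\<close> of a sequence with \<open>k \<ge> n\<close> are meaningless and are never used.\<close>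

definition basis_indices :: "'a::real_vector itself \<Rightarrow> nat set" where
  "basis_indices _ = (if finite_dim TYPE('a) then {..<dim (UNIV :: 'a set)} else UNIV)"

definition schauder_basis :: "(nat \<Rightarrow> 'a::real_normed_vector) \<Rightarrow> bool" where
  "schauder_basis e \<longleftrightarrow>
     (if finite_dim TYPE('a)
      then inj_on e (basis_indices TYPE('a)) \<and> independent (e ` basis_indices TYPE('a)) \<and>
           span (e ` basis_indices TYPE('a)) = UNIV
      else (\<forall>x. \<exists>!c :: nat \<Rightarrow> real. (\<lambda>k. c k *\<^sub>R e k) sums x))"

definition coord :: "(nat \<Rightarrow> 'a::real_normed_vector) \<Rightarrow> 'a \<Rightarrow> nat \<Rightarrow> real" where
  "coord e x k =
     (if finite_dim TYPE('a)
      then representation (e ` basis_indices TYPE('a)) x (e k)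
      else (THE c :: nat \<Rightarrow> real. (\<lambda>k. c k *\<^sub>R e k) sums x) k)"

definition componentwise_convergent ::
  "(nat \<Rightarrow> 'a::real_normed_vector) \<Rightarrow> (nat \<Rightarrow> 'a) \<Rightarrow> bool" where
  "componentwise_convergent e x \<longleftrightarrow>
     (\<forall>k \<in> basis_indices TYPE('a). convergent (\<lambda>i. coord e (x i) k))"

text \<open>The weak topology is the initial topology for all bounded linear functionals, i.e. the
  pullback of the product topology on \<open>('a \<Rightarrow>\<^sub>L real) \<Rightarrow> real\<close>. For real-valued operators, the
  library's strong operator topology is the topology of pointwise convergence on the dual space,
  that is, the weak* topology.\<close>

definition weak_topology :: "'a::real_normed_vector topology" where
  "weak_topology =
     pullback_topology UNIV (\<lambda>x. \<lambda>\<phi> :: 'a \<Rightarrow>\<^sub>L real. blinfun_apply \<phi> x) euclidean"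

abbreviation weak_star_topology :: "('a::real_normed_vector \<Rightarrow>\<^sub>L real) topology" where
  "weak_star_topology \<equiv> strong_operator_topology"

lemma limitin_pullback_euclidean:
  fixes T :: "'a \<Rightarrow> 'b \<Rightarrow> real"
  shows "limitin (pullback_topology UNIV T euclidean) x l F \<longleftrightarrow> (\<forall>b. ((\<lambda>i. T (x i) b) \<longlongrightarrow> T l b) F)"
proof -
  have "limitin (pullback_topology UNIV T euclidean) x l F \<longleftrightarrow> ((\<lambda>i. T (x i)) \<longlongrightarrow> T l) F"
    by (auto simp: limitin_def openin_pullback_topology tendsto_def topspace_pullback_topology)
  also have "\<dots> \<longleftrightarrow> (\<forall>b. ((\<lambda>i. T (x i) b) \<longlongrightarrow> T l b) F)"
    using limitin_componentwise[of "\<lambda>_ :: 'b. euclidean :: real topology" UNIV "\<lambda>i. T (x i)" "T l" F]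
    by (simp add: euclidean_product_topology)
  finally show ?thesis .
qed

lemma limitin_weak_topology:
  "limitin weak_topology x l F \<longleftrightarrow>
     (\<forall>\<phi> :: 'a::real_normed_vector \<Rightarrow>\<^sub>L real. ((\<lambda>i. blinfun_apply \<phi> (x i)) \<longlongrightarrow> blinfun_apply \<phi> l) F)"
  unfolding weak_topology_def limitin_pullback_euclidean ..

lemma limitin_weak_star_topology:
  "limitin weak_star_topology \<phi> l F \<longleftrightarrow>
     (\<forall>z. ((\<lambda>i. blinfun_apply (\<phi> i) z) \<longlongrightarrow> blinfun_apply l z) F)"
  unfolding strong_operator_topology_def limitin_pullback_euclidean ..

definition component_star_property ::
  "(nat \<Rightarrow> 'a::banach) \<Rightarrow> (nat \<Rightarrow> 'a \<Rightarrow>\<^sub>L real) \<Rightarrow> bool" where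
  "component_star_property e f \<longleftrightarrow>
     schauder_basis e \<and> schauder_basis f \<and>
     (\<forall>\<phi> :: nat \<Rightarrow> 'a \<Rightarrow>\<^sub>L real.
        bounded (range \<phi>) \<and> componentwise_convergent f \<phi> \<longrightarrow>
        (\<exists>\<psi>. limitin weak_star_topology \<phi> \<psi> sequentially))"

definition basis_projection ::
  "(nat \<Rightarrow> 'a::real_normed_vector) \<Rightarrow> nat set \<Rightarrow> 'a \<Rightarrow> 'a" where
  "basis_projection e I x = (\<Sum>k\<in>I. coord e x k *\<^sub>R e k)"

definition depends_on_finitely_many_components ::
  "(nat \<Rightarrow> 'a::real_normed_vector) \<Rightarrow> 'a set \<Rightarrow> ('a \<Rightarrow> real) \<Rightarrow> bool" where
  "depends_on_finitely_many_components e U g \<longleftrightarrow>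
     (\<exists>I g'. I \<noteq> {} \<and> finite I \<and> I \<subseteq> basis_indices TYPE('a) \<and>
        continuous_on (basis_projection e I ` U) g' \<and>
        (\<forall>x\<in>U. g x = g' (basis_projection e I x)))"

definition weak_to_weak_star_seq_continuous_on ::
  "'a::real_normed_vector set \<Rightarrow> ('a \<Rightarrow> 'a \<Rightarrow>\<^sub>L real) \<Rightarrow> bool" where
  "weak_to_weak_star_seq_continuous_on U h \<longleftrightarrow>
     (\<forall>x l. (\<forall>i :: nat. x i \<in> U) \<and> l \<in> U \<and> limitin weak_topology x l sequentially \<longrightarrow>
        (\<forall>z. (\<lambda>i. blinfun_apply (h (x i)) z) \<longlonglongrightarrow> blinfun_apply (h l) z))"

end

theory Submission
  imports Defs
begin

text \<open>
  Let \<open>x i \<rightarrow> l\<close> weakly in \<open>U\<close>. A weakly convergent sequence is bounded, so \<open>h (x i)\<close> is bounded.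
  The coordinate functionals of a Schauder basis are continuous, hence
  the coordinates of \<open>x i\<close> converge to those of \<open>l\<close>, and any function of finitely many components that
  is continuous in them converges along \<open>x i\<close>; so \<open>h (x i)\<close> converges to \<open>h l\<close> coordinate by
  coordinate. The component-* property then supplies a weak* limit. It does not
  say which limit, but applied to the interleaved sequence
  \<open>h (x 0), h l, h (x 1), h l, \<dots>\<close>, which is still bounded and component-wise convergent, it leaves
  \<open>h l\<close> as the only possibility (\<open>weak_star_limit_eq_coordinatewise_limit\<close>).

  The functional analysis behind this rests on two principles. Zabreiko's lemma (\<open>Zabreiko\<close>)
  says that a countably subadditive seminorm on a Banach space is bounded by a multiple of the norm. For the
  supremum of a pointwise bounded family of operators it is the uniform boundedness principle; for
  the supremum of the norms of the partial sums of a basis expansion it is the continuity of the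
  coordinates. The Hahn--Banach theorem, in the form that every vector has a norming functional,
  turns the uniform bound on the \<open>x i\<close> as functionals on the dual space into a bound on their norms.
\<close>

section \<open>Countably subadditive seminorms\<close>

text \<open>By Baire's theorem some sublevel set of \<open>p\<close> is dense in a ball, and since \<open>p\<close> is a seminorm this
  ball can be centred at the origin. So each vector \<open>z\<close> is a limit of vectors \<open>w\<close> with
  \<open>p w \<le> K * norm z\<close>. Approximating a vector in this way, then the remainder, and so on with errors
  halved in each step, writes it as a series to which countable subadditivity applies.\<close>

lemma Zabreiko:
  fixes p :: "'a::banach \<Rightarrow> real"
  assumes homog: "\<And>c x. p (c *\<^sub>R x) = \<bar>c\<bar> * p x"
    and subadd: "\<And>y x. y sums x \<Longrightarrow> summable (\<lambda>m. p (y m)) \<Longrightarrow> p x \<le> (\<Sum>m. p (y m))"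
  shows "\<exists>C\<ge>0. \<forall>x. p x \<le> C * norm x"
proof -
  have p0: "p 0 = 0" using homog[of 0 0] by simp
  \<comment> \<open>A finite sum is a series with zero tail.\<close>
  have add: "p (x + y) \<le> p x + p y" for x y
  proof -
    let ?y = "\<lambda>m. if m = 0 then x else if m = Suc 0 then y else 0"
    have out: "m \<notin> {..<2} \<Longrightarrow> ?y m = 0" for m :: nat by auto
    have "?y sums (\<Sum>m<2. ?y m)"
      by (rule sums_finite) (use out in auto)
    moreover have "(\<lambda>m. p (?y m)) sums (\<Sum>m<2. p (?y m))"
      by (rule sums_finite) (use out p0 in auto)
    ultimately show ?thesis
      using subadd[of ?y "x + y"] by (simp add: sums_iff numeral_2_eq_2)
  qed
  have minus: "p (- x) = p x" for x using homog[of "-1" x] by simp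
  have diff: "p (x - y) \<le> p x + p y" for x y using add[of x "- y"] minus by simp
  define A where "A N = {x. p x \<le> real N}" for N
  obtain N where N: "interior (closure (A N)) \<noteq> {}"
  proof (rule ccontr)
    assume "\<not> thesis"
    then have empty: "interior (closure (A N)) = {}" for N using that by auto
    have "euclidean closure_of \<Inter>(range (\<lambda>N. - closure (A N))) = UNIV"
    proof (rule Met_TC.metric_Baire_category[unfolded mtopology_is_euclidean])
      show "Met_TC.mcomplete TYPE('a)" by (simp add: mcomplete_iff_complete complete_UNIV)
    qed (auto simp: empty closure_complement)
    moreover have "\<Inter>(range (\<lambda>N. - closure (A N))) = {}"
    proof -
      have "\<exists>N. x \<in> closure (A N)" for x
      proof -
        obtain N where "p x \<le> real N" using real_arch_simple by blast
        then have "x \<in> A N" by (simp add: A_def)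
        then show ?thesis using closure_subset[of "A N"] by auto
      qed
      then show ?thesis by auto
    qed
    ultimately show False by simp
  qed
  then obtain a r where r: "r > 0" "ball a r \<subseteq> closure (A N)"
    by (metis ex_in_conv interior_subset open_contains_ball open_interior subset_trans)
  \<comment> \<open>Half the difference of approximants of \<open>a + z\<close> and \<open>a - z\<close> approximates \<open>z\<close>; this moves the ball to
    the origin.\<close>
  have near: "\<exists>w. p w \<le> real N \<and> norm (z - w) < \<epsilon>" if "norm z < r" "\<epsilon> > 0" for z \<epsilon>
  proof -
    have "a + z \<in> closure (A N)" "a - z \<in> closure (A N)"
      using r that by (auto intro!: subsetD[OF r(2)] simp: dist_norm)
    then obtain u v where u: "u \<in> A N" "dist u (a + z) < \<epsilon>" and v: "v \<in> A N" "dist v (a - z) < \<epsilon>"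
      using \<open>\<epsilon> > 0\<close> unfolding closure_approachable by blast
    define w where "w = (1/2) *\<^sub>R (u - v)"
    have pw: "p w \<le> real N"
      using diff[of u v] u v by (simp add: w_def homog A_def)
    have "2 *\<^sub>R (z - w) = ((a + z) - u) - ((a - z) - v)"
      by (simp add: w_def scaleR_diff_right) (simp add: scaleR_2)
    then have "2 * norm (z - w) = norm (((a + z) - u) - ((a - z) - v))"
      by (metis norm_scaleR abs_numeral)
    also have "\<dots> \<le> norm ((a + z) - u) + norm ((a - z) - v)"
      by (rule norm_triangle_ineq4)
    finally have "norm (z - w) < \<epsilon>"
      using u v by (simp add: dist_norm norm_minus_commute)
    with pw show ?thesis by blast
  qed
  define K where "K = 2 * real N / r"
  have K0: "K \<ge> 0" using r by (simp add: K_def)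
  have approx: "\<exists>w. p w \<le> K * norm z \<and> norm (z - w) < \<epsilon>" if "\<epsilon> > 0" for z \<epsilon>
  proof (cases "z = 0")
    case True
    then show ?thesis using that p0 by (intro exI[of _ 0]) auto
  next
    case False
    \<comment> \<open>Scaling \<open>z\<close> to norm \<open>r / 2\<close> brings it inside the ball of radius \<open>r\<close>.\<close>
    define t where "t = r / (2 * norm z)"
    have t: "t > 0" using False r by (simp add: t_def)
    have "norm (t *\<^sub>R z) < r" using False r by (simp add: t_def)
    then obtain w where w: "p w \<le> real N" "norm (t *\<^sub>R z - w) < t * \<epsilon>"
      using near[of "t *\<^sub>R z" "t * \<epsilon>"] t \<open>\<epsilon> > 0\<close> by auto
    have "z - (1/t) *\<^sub>R w = (1/t) *\<^sub>R (t *\<^sub>R z - w)"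
      using t by (simp add: scaleR_diff_right)
    then have "norm (z - (1/t) *\<^sub>R w) < \<epsilon>"
      using w(2) t by (simp add: divide_less_eq mult.commute)
    moreover have "p ((1/t) *\<^sub>R w) \<le> K * norm z"
      using w(1) t r False by (simp add: homog K_def t_def field_simps)
    ultimately show ?thesis by blast
  qed
  have "p x \<le> (2 * K) * norm x" for x
  proof (cases "x = 0")
    case True
    then show ?thesis by (simp add: p0)
  next
    case False
    have "\<forall>z \<epsilon>. \<exists>w. \<epsilon> > 0 \<longrightarrow> p w \<le> K * norm z \<and> norm (z - w) < \<epsilon>"
      using approx by blast
    then obtain W where W: "\<And>z \<epsilon>. \<epsilon> > 0 \<Longrightarrow> p (W z \<epsilon>) \<le> K * norm z \<and> norm (z - W z \<epsilon>) < \<epsilon>"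
      by metis
    \<comment> \<open>\<open>w m\<close> approximates the remainder \<open>z m\<close> left after the terms before it.\<close>
    define z where "z = rec_nat x (\<lambda>m z. z - W z (norm x / 2 ^ Suc m))"
    define w where "w m = W (z m) (norm x / 2 ^ Suc m)" for m
    have z0: "z 0 = x" and zS: "z (Suc m) = z m - w m" for m
      by (simp_all add: z_def w_def)
    have pos: "norm x / 2 ^ m > 0" for m using False by simp
    have zle: "norm (z m) \<le> norm x / 2 ^ m" for m
    proof (cases m)
      case (Suc k)
      then show ?thesis using W[OF pos[of "Suc k"], of "z k"] by (simp add: zS w_def)
    qed (simp add: z0)
    have pw: "p (w m) \<le> K * norm x * (1/2) ^ m" for m
    proof -
      have "p (w m) \<le> K * norm (z m)" unfolding w_def using W[OF pos] by blast
      also have "\<dots> \<le> K * (norm x / 2 ^ m)" by (intro mult_left_mono zle K0)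
      finally show ?thesis by (simp add: power_one_over)
    qed
    have geo: "(\<lambda>m. K * norm x * (1/2) ^ m) sums (K * norm x * 2)"
      using sums_mult[OF geometric_sums[of "1/2::real"], of "K * norm x"] by simp
    have pnn: "0 \<le> p y" for y using add[of y "- y"] minus[of y] p0 by simp
    have sm: "summable (\<lambda>m. p (w m))"
      using pw pnn by (intro summable_comparison_test'[OF sums_summable[OF geo], of 0]) auto
    have "(\<lambda>m. norm x / 2 ^ m) \<longlonglongrightarrow> 0"
      by (rule LIMSEQ_divide_realpow_zero) simp
    then have z_lim: "z \<longlonglongrightarrow> 0"
      by (rule Lim_null_comparison[rotated]) (simp add: zle)
    have "(\<Sum>m<n. w m) = x - z n" for n
      by (induction n) (simp_all add: z0 zS)
    then have "w sums x"
      unfolding sums_def using tendsto_diff[OF tendsto_const z_lim, of x] by simp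
    then have "p x \<le> (\<Sum>m. p (w m))" using sm by (rule subadd)
    also have "\<dots> \<le> (\<Sum>m. K * norm x * (1/2) ^ m)"
      using pw sm sums_summable[OF geo] by (rule suminf_le)
    also have "\<dots> = 2 * K * norm x" using geo by (simp add: sums_iff)
    finally show ?thesis .
  qed
  then show ?thesis using K0 by (intro exI[of _ "2 * K"]) auto
qed

text \<open>The supremum of the seminorms \<open>\<lambda>x. norm (T i x)\<close> is countably subadditive because each of them is,
  by continuity of \<open>T i\<close>.\<close>

lemma Banach_Steinhaus:
  fixes T :: "'i \<Rightarrow> 'a::banach \<Rightarrow>\<^sub>L 'b::real_normed_vector"
  assumes "\<And>x. bounded (range (\<lambda>i. T i x))"
  shows "bounded (range T)"
proof -
  define p where "p x = (SUP i. norm (T i x))" for x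
  have bdd: "bdd_above (range (\<lambda>i. norm (T i x)))" for x
    using assms[of x] by (auto simp: bounded_iff bdd_above_def)
  have le_p: "norm (T i x) \<le> p x" for i x
    unfolding p_def by (rule cSUP_upper[OF UNIV_I bdd])
  have scale_le: "p (c *\<^sub>R x) \<le> \<bar>c\<bar> * p x" for c x
    unfolding p_def[of "c *\<^sub>R x"]
    by (rule cSUP_least) (auto simp: blinfun.scaleR_right intro!: mult_left_mono le_p)
  have "\<exists>C\<ge>0. \<forall>x. p x \<le> C * norm x"
  proof (rule Zabreiko)
    show "p (c *\<^sub>R x) = \<bar>c\<bar> * p x" for c x
    proof (cases "c = 0")
      case True
      then show ?thesis by (simp add: p_def)
    next
      case False
      then have "\<bar>c\<bar> * p x \<le> p (c *\<^sub>R x)"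
        using scale_le[of "inverse c" "c *\<^sub>R x"] by (simp add: field_simps)
      then show ?thesis using scale_le[of c x] by simp
    qed
    show "p x \<le> (\<Sum>m. p (y m))" if y: "y sums x" and sm: "summable (\<lambda>m. p (y m))" for y x
      unfolding p_def[of x]
    proof (rule cSUP_least)
      fix i
      have lim: "(\<lambda>n. \<Sum>m<n. T i (y m)) \<longlonglongrightarrow> T i x"
        using bounded_linear.sums[OF blinfun.bounded_linear_right y, of "T i"] by (simp add: sums_def)
      have "norm (\<Sum>m<n. T i (y m)) \<le> (\<Sum>m. p (y m))" for n
      proof -
        have "norm (\<Sum>m<n. T i (y m)) \<le> (\<Sum>m<n. p (y m))"
          by (rule sum_norm_le) (rule le_p)
        also have "\<dots> \<le> (\<Sum>m. p (y m))"
          by (rule sum_le_suminf[OF sm]) (auto intro: order_trans[OF norm_ge_zero le_p])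
        finally show ?thesis .
      qed
      then show "norm (T i x) \<le> (\<Sum>m. p (y m))"
        by (intro tendsto_upperbound[OF tendsto_norm[OF lim]]) auto
    qed simp
  qed
  then obtain C where C: "C \<ge> 0" "\<And>x. p x \<le> C * norm x" by blast
  have "norm (T i) \<le> C" for i
    by (rule norm_blinfun_bound[OF C(1)]) (meson le_p C(2) order_trans)
  then show ?thesis by (auto simp: bounded_iff)
qed

section \<open>Coordinate functionals of a Schauder basis\<close>

text \<open>The supremum \<open>p x\<close> of the norms of the partial sums \<open>P n x\<close> of the expansion of \<open>x\<close> dominates
  every coefficient, as \<open>c x j *\<^sub>R e j\<close> is a difference of consecutive partial sums. It is countably
  subadditive: if \<open>y sums x\<close> with \<open>p (y m)\<close> summable, then the coefficients of the \<open>y m\<close> can be summed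
  separately, and the resulting series converges to \<open>x\<close> by uniform convergence, so by uniqueness it is the
  expansion of \<open>x\<close>. Hence Zabreiko's lemma bounds \<open>p\<close>. The set \<open>J\<close> of admissible indices lets finite bases, whose
  members beyond the dimension are arbitrary, share the argument with infinite ones.\<close>

lemma coefficient_functionals_bounded_linear:
  fixes e :: "nat \<Rightarrow> 'a::banach" and c :: "'a \<Rightarrow> nat \<Rightarrow> real"
  assumes supp: "\<And>x k. k \<notin> J \<Longrightarrow> c x k = 0"
    and sums: "\<And>x. (\<lambda>k. c x k *\<^sub>R e k) sums x"
    and unique: "\<And>x d. (\<And>k. k \<notin> J \<Longrightarrow> d k = 0) \<Longrightarrow> (\<lambda>k. d k *\<^sub>R e k) sums x \<Longrightarrow> d = c x"
  shows "bounded_linear (\<lambda>x. c x k)"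
proof (cases "k \<in> J")
  case False
  then show ?thesis by (simp add: supp)
next
  case True
  have c_add: "c (x + y) j = c x j + c y j" for x y j
    using unique[of "\<lambda>j. c x j + c y j" "x + y"] sums_add[OF sums[of x] sums[of y]]
    by (simp add: supp scaleR_add_left fun_eq_iff)
  have c_scale: "c (t *\<^sub>R x) j = t * c x j" for t x j
    using unique[of "\<lambda>j. t * c x j" "t *\<^sub>R x"]
      bounded_linear.sums[OF bounded_linear_scaleR_right sums[of x], of t]
    by (simp add: supp fun_eq_iff)
  \<comment> \<open>If \<open>e j = 0\<close>, then \<open>0\<close> has two expansions.\<close>
  have nz: "e j \<noteq> 0" if "j \<in> J" for j
  proof
    assume "e j = 0"
    then have "(\<lambda>i. (if i = j then 1 else 0::real) *\<^sub>R e i) = (\<lambda>i. 0)" by auto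
    then have "(\<lambda>i. if i = j then 1 else 0) = c 0"
      using that by (intro unique) auto
    moreover have "(\<lambda>i. 0) = c 0" by (rule unique) auto
    ultimately have "(\<lambda>i. if i = j then 1 else 0) = (\<lambda>i. 0::real)" by simp
    from fun_cong[OF this, of j] show False by simp
  qed
  define P where "P n x = (\<Sum>j<n. c x j *\<^sub>R e j)" for n x
  define p where "p x = (SUP n. norm (P n x))" for x
  have P_lim: "(\<lambda>n. P n x) \<longlonglongrightarrow> x" for x
    using sums[of x] by (simp add: sums_def P_def)
  have bdd: "bdd_above (range (\<lambda>n. norm (P n x)))" for x
    using convergent_imp_bounded[OF P_lim[of x]] by (auto simp: bounded_iff bdd_above_def)
  have le_p: "norm (P n x) \<le> p x" for n x
    unfolding p_def by (rule cSUP_upper[OF UNIV_I bdd])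
  have coeff_le: "\<bar>c x j\<bar> * norm (e j) \<le> 2 * p x" for x j
  proof -
    have "c x j *\<^sub>R e j = P (Suc j) x - P j x" by (simp add: P_def)
    then have "norm (c x j *\<^sub>R e j) \<le> norm (P (Suc j) x) + norm (P j x)"
      by (metis norm_triangle_ineq4)
    then show ?thesis using le_p[of "Suc j" x] le_p[of j x] by simp
  qed
  have "\<exists>C\<ge>0. \<forall>x. p x \<le> C * norm x"
  proof (rule Zabreiko)
    show "p (t *\<^sub>R x) = \<bar>t\<bar> * p x" for t x
    proof -
      have "P n (t *\<^sub>R x) = t *\<^sub>R P n x" for n
        by (simp add: P_def c_scale scaleR_sum_right)
      then have eq: "norm (P n (t *\<^sub>R x)) = \<bar>t\<bar> * norm (P n x)" for n by simp
      show ?thesis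
      proof (cases "t = 0")
        case True
        then show ?thesis unfolding p_def eq by simp
      next
        case False
        have "p (t *\<^sub>R x) \<le> \<bar>t\<bar> * p x"
          unfolding p_def[of "t *\<^sub>R x"] eq by (rule cSUP_least) (auto intro!: mult_left_mono le_p)
        moreover have "p x \<le> p (t *\<^sub>R x) / \<bar>t\<bar>"
          unfolding p_def[of x] using eq le_p[of _ "t *\<^sub>R x"] False
          by (intro cSUP_least) (auto simp: field_simps)
        ultimately show ?thesis using False by (simp add: field_simps)
      qed
    qed
    show "p x \<le> (\<Sum>m. p (y m))" if y: "y sums x" and sm: "summable (\<lambda>m. p (y m))" for y x
    proof -
      have c_sm: "summable (\<lambda>m. c (y m) j)" for j
      proof (cases "j \<in> J")
        case True
        have "norm (c (y m) j) \<le> (2 / norm (e j)) * p (y m)" for m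
          using coeff_le[of "y m" j] nz[OF True] by (simp add: field_simps)
        then show ?thesis
          by (intro summable_comparison_test'[OF summable_mult[OF sm, of "2 / norm (e j)"], of 0])
      qed (simp add: supp)
      define d where "d j = (\<Sum>m. c (y m) j)" for j
      have S: "(\<Sum>j<n. d j *\<^sub>R e j) = (\<Sum>m. P n (y m))" for n
      proof -
        have "(\<Sum>j<n. d j *\<^sub>R e j) = (\<Sum>j<n. \<Sum>m. c (y m) j *\<^sub>R e j)"
          unfolding d_def
          by (intro sum.cong refl bounded_linear.suminf[OF bounded_linear_scaleR_left c_sm])
        also have "\<dots> = (\<Sum>m. P n (y m))"
          unfolding P_def
          by (rule suminf_sum[symmetric]) (rule bounded_linear.summable[OF bounded_linear_scaleR_left c_sm])
        finally show ?thesis .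
      qed
      have "uniform_limit UNIV (\<lambda>N n. \<Sum>m<N. P n (y m)) (\<lambda>n. \<Sum>m. P n (y m)) sequentially"
        using le_p by (intro Weierstrass_m_test[OF _ sm]) auto
      then have "(\<lambda>n. \<Sum>m. P n (y m)) \<longlonglongrightarrow> x"
      proof (rule swap_uniform_limit'[rotated 2])
        \<comment> \<open>The limits in \<open>n\<close> and in the number \<open>N\<close> of summands may be interchanged.\<close>
        show "\<forall>\<^sub>F N in sequentially. (\<lambda>n. \<Sum>m<N. P n (y m)) \<longlonglongrightarrow> (\<Sum>m<N. y m)"
          by (intro always_eventually allI tendsto_sum P_lim)
        show "(\<lambda>N. \<Sum>m<N. y m) \<longlonglongrightarrow> x" using y by (simp add: sums_def)
      qed auto
      then have "(\<lambda>j. d j *\<^sub>R e j) sums x" by (simp add: sums_def S)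
      then have "d = c x" by (rule unique[rotated]) (simp add: d_def supp)
      then have P_x: "P n x = (\<Sum>m. P n (y m))" for n
        using S[of n] by (simp add: P_def)
      show ?thesis
        unfolding p_def[of x] P_x
        by (rule cSUP_least) (auto intro!: norm_suminf_le[OF _ sm] le_p)
    qed
  qed
  then obtain C where C: "\<And>x. p x \<le> C * norm x" by blast
  show ?thesis
  proof (rule bounded_linear_intro)
    show "norm (c x k) \<le> norm x * (2 * C / norm (e k))" for x
    proof -
      have "\<bar>c x k\<bar> * norm (e k) \<le> 2 * (C * norm x)"
        using coeff_le[of x k] C[of x] by linarith
      then show ?thesis using nz[OF True] by (simp add: field_simps)
    qed
  qed (simp_all add: c_add c_scale)
qed

text \<open>Both cases of the definition of a Schauder basis take the form of unique series expansions whose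
  coefficients vanish outside the index set.\<close>

lemma coord_sums:
  fixes e :: "nat \<Rightarrow> 'a::real_normed_vector"
  assumes "schauder_basis e"
  defines "J \<equiv> basis_indices TYPE('a)"
  shows "(\<lambda>k. (if k \<in> J then coord e x k else 0) *\<^sub>R e k) sums x"
    and "\<lbrakk>\<And>k. k \<notin> J \<Longrightarrow> d k = 0; (\<lambda>k. d k *\<^sub>R e k) sums x\<rbrakk>
      \<Longrightarrow> d = (\<lambda>k. if k \<in> J then coord e x k else 0)"
proof -
  show "(\<lambda>k. (if k \<in> J then coord e x k else 0) *\<^sub>R e k) sums x"
  proof (cases "finite_dim TYPE('a)")
    case True
    have J: "finite J" using True by (simp add: J_def basis_indices_def)
    have inj: "inj_on e J" and ind: "independent (e ` J)" and sp: "span (e ` J) = UNIV"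
      using assms True by (auto simp: schauder_basis_def)
    have "(\<Sum>k\<in>J. (if k \<in> J then coord e x k else 0) *\<^sub>R e k)
        = (\<Sum>b\<in>e ` J. representation (e ` J) x b *\<^sub>R b)"
      using inj True by (simp add: sum.reindex coord_def J_def)
    also have "\<dots> = x"
      using sum_representation_eq[OF ind, of x "e ` J"] sp J by auto
    finally show ?thesis
      using sums_finite[OF J, of "\<lambda>k. (if k \<in> J then coord e x k else 0) *\<^sub>R e k"] by simp
  next
    case False
    then have "\<exists>!c :: nat \<Rightarrow> real. (\<lambda>k. c k *\<^sub>R e k) sums x"
      using assms by (simp add: schauder_basis_def)
    from theI'[OF this] show ?thesis
      using False by (simp add: J_def basis_indices_def coord_def)
  qed
  assume d: "\<And>k. k \<notin> J \<Longrightarrow> d k = 0" "(\<lambda>k. d k *\<^sub>R e k) sums x"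
  show "d = (\<lambda>k. if k \<in> J then coord e x k else 0)"
  proof (cases "finite_dim TYPE('a)")
    case True
    have J: "finite J" using True by (simp add: J_def basis_indices_def)
    have inj: "inj_on e J" and ind: "independent (e ` J)" and sp: "span (e ` J) = UNIV"
      using assms True by (auto simp: schauder_basis_def)
    have "x = (\<Sum>k\<in>J. d k *\<^sub>R e k)"
      using sums_unique2[OF d(2) sums_finite[OF J]] d(1) by simp
    then have rep: "representation (e ` J) x b = (\<Sum>i\<in>J. d i * representation (e ` J) (e i) b)" for b
      using ind sp by (simp add: representation_sum representation_scale)
    have "coord e x k = d k" if "k \<in> J" for k
    proof -
      have "representation (e ` J) (e i) (e k) = (if k = i then 1 else 0)" if "i \<in> J" for i
        using that \<open>k \<in> J\<close> inj by (simp add: representation_basis[OF ind] inj_on_eq_iff)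
      then have "representation (e ` J) x (e k) = (\<Sum>i\<in>J. if k = i then d i else 0)"
        unfolding rep by (intro sum.cong) auto
      then show ?thesis using that J True by (simp add: coord_def J_def)
    qed
    then show ?thesis using d(1) by auto
  next
    case False
    then have "\<exists>!c :: nat \<Rightarrow> real. (\<lambda>k. c k *\<^sub>R e k) sums x"
      using assms by (simp add: schauder_basis_def)
    from the1_equality[of "\<lambda>c. (\<lambda>k. c k *\<^sub>R e k) sums x", OF this d(2)] show ?thesis
      using False by (simp add: J_def basis_indices_def coord_def)
  qed
qed

lemma coord_bounded_linear:
  fixes e :: "nat \<Rightarrow> 'a::banach"
  assumes "schauder_basis e" "k \<in> basis_indices TYPE('a)"
  shows "bounded_linear (\<lambda>x. coord e x k)"
  using coefficient_functionals_bounded_linear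
      [of "basis_indices TYPE('a)" "\<lambda>x k. if k \<in> basis_indices TYPE('a) then coord e x k else 0" e k]
    coord_sums[OF assms(1)] assms(2)
  by simp

section \<open>Norming functionals\<close>

definition sublinear :: "('a::real_vector \<Rightarrow> real) \<Rightarrow> bool" where
  "sublinear p \<longleftrightarrow> (\<forall>x y. p (x + y) \<le> p x + p y) \<and> (\<forall>t x. t > 0 \<longrightarrow> p (t *\<^sub>R x) = t * p x)"

lemma sublinearI:
  assumes "\<And>x y. p (x + y) \<le> p x + p y" "\<And>t x. t > 0 \<Longrightarrow> p (t *\<^sub>R x) \<le> t * p x"
  shows "sublinear p"
proof -
  have "t * p x \<le> p (t *\<^sub>R x)" if "t > 0" for t x
    using assms(2)[of "1/t" "t *\<^sub>R x"] that by (simp add: field_simps)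
  then show ?thesis using assms by (auto simp: sublinear_def intro: antisym)
qed

lemma
  assumes "sublinear p"
  shows sublinear_add: "p (x + y) \<le> p x + p y"
    and sublinear_scaleR: "t > 0 \<Longrightarrow> p (t *\<^sub>R x) = t * p x"
    and sublinear_0: "p 0 = 0"
    and sublinear_minus: "- p (- x) \<le> p x"
proof -
  show add: "p (x + y) \<le> p x + p y" for x y using assms by (simp add: sublinear_def)
  show scale: "t > 0 \<Longrightarrow> p (t *\<^sub>R x) = t * p x" for t x using assms by (simp add: sublinear_def)
  show "p 0 = 0" using scale[of 2 0] by simp
  then show "- p (- x) \<le> p x" using add[of x "- x"] by simp
qed

text \<open>The largest sublinear \<open>q \<le> p\<close> with \<open>q (- y) \<le> - p y\<close> is the infimum of
  \<open>p (x + t *\<^sub>R y) - t * p y\<close> over \<open>t \<ge> 0\<close>. The lemma serves twice. If \<open>p\<close> is minimal, then \<open>q = p\<close>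
  and so \<open>p (- y) \<le> - p y\<close>, which makes \<open>p\<close> linear. If \<open>p\<close> is the norm, then a linear functional below
  \<open>q\<close> takes the value \<open>norm y\<close> at \<open>y\<close>.\<close>

lemma sublinear_minorant_in_direction:
  assumes p: "sublinear p"
  shows "\<exists>q. sublinear q \<and> q \<le> p \<and> q (- y) \<le> - p y"
proof -
  define g where "g x t = p (x + t *\<^sub>R y) - t * p y" for x t
  define q where "q x = (INF t\<in>{0..}. g x t)" for x
  have scale: "p (t *\<^sub>R x) = t * p x" if "t \<ge> 0" for t x
    using sublinear_scaleR[OF p, of t x] sublinear_0[OF p] that by (cases "t = 0") auto
  have "- p (- x) \<le> g x t" if "t \<ge> 0" for x t
    using sublinear_add[OF p, of "x + t *\<^sub>R y" "- x"] scale[OF that, of y] by (simp add: g_def)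
  then have bdd: "bdd_below (g x ` {0..})" for x
    by (auto simp: bdd_below_def)
  have q_le: "q x \<le> g x t" if "t \<ge> 0" for x t
    unfolding q_def using that by (intro cINF_lower[OF bdd]) auto
  have q_ge: "l \<le> q x" if "\<And>t. t \<ge> 0 \<Longrightarrow> l \<le> g x t" for l x
    unfolding q_def using that by (intro cINF_greatest) auto
  have "sublinear q"
  proof (rule sublinearI)
    fix x z
    have "q (x + z) - g x s \<le> g z t" if "s \<ge> 0" "t \<ge> 0" for s t
    proof -
      have "g (x + z) (s + t) \<le> g x s + g z t"
        using sublinear_add[OF p, of "x + s *\<^sub>R y" "z + t *\<^sub>R y"] by (simp add: g_def algebra_simps)
      then show ?thesis using q_le[of "s + t" "x + z"] that by simp
    qed
    then have "q (x + z) - g x s \<le> q z" if "s \<ge> 0" for s using that by (intro q_ge) auto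
    then have "q (x + z) - q z \<le> q x" by (intro q_ge) (auto simp: algebra_simps)
    then show "q (x + z) \<le> q x + q z" by simp
  next
    fix t :: real and x assume t: "t > 0"
    have "q (t *\<^sub>R x) / t \<le> g x s" if "s \<ge> 0" for s
    proof -
      have "g (t *\<^sub>R x) (t * s) = t * g x s"
        using sublinear_scaleR[OF p t, of "x + s *\<^sub>R y"] by (simp add: g_def algebra_simps)
      then show ?thesis using q_le[of "t * s" "t *\<^sub>R x"] t that by (simp add: field_simps)
    qed
    then have "q (t *\<^sub>R x) / t \<le> q x" by (rule q_ge)
    then show "q (t *\<^sub>R x) \<le> t * q x" using t by (simp add: field_simps)
  qed
  moreover have "q \<le> p" using q_le[of 0] by (auto simp: le_fun_def g_def)
  moreover have "q (- y) \<le> - p y" using q_le[of 1 "- y"] by (simp add: g_def sublinear_0[OF p])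
  ultimately show ?thesis by blast
qed

text \<open>By Zorn's lemma there is a minimal sublinear functional \<open>m \<le> p\<close>; the pointwise infimum of a
  chain is again sublinear. As \<open>m\<close> is equal to each of its minorants in a direction, it is odd, and an
  odd sublinear functional is linear.\<close>

lemma linear_minorant:
  assumes p: "sublinear p"
  shows "\<exists>f. linear f \<and> f \<le> p"
proof -
  define A where "A = {q. sublinear q \<and> q \<le> p}"
  have "\<exists>m\<in>A. \<forall>q\<in>A. q \<le> m \<longrightarrow> q = m"
  proof (rule predicate_Zorn)
    show "partial_order_on A (relation_of (\<lambda>a b. b \<le> a) A)"
      by (rule partial_order_on_relation_ofI) auto
  next
    fix C assume C: "C \<in> Chains (relation_of (\<lambda>a b. b \<le> a) A)"
    show "\<exists>u\<in>A. \<forall>a\<in>C. u \<le> a"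
    proof (cases "C = {}")
      case True
      then show ?thesis using p by (auto simp: A_def)
    next
      case False
      have CA: "sublinear q" "q \<le> p" if "q \<in> C" for q
        using C that by (auto simp: Chains_def relation_of_def A_def)
      have tot: "q \<le> q' \<or> q' \<le> q" if "q \<in> C" "q' \<in> C" for q q'
        using C that by (auto simp: Chains_def relation_of_def)
      define u where "u x = (INF q\<in>C. q x)" for x
      have "- p (- x) \<le> q x" if "q \<in> C" for q x
        using sublinear_minus[OF CA(1)[OF that], of x] le_funD[OF CA(2)[OF that], of "- x"] by simp
      then have bdd: "bdd_below ((\<lambda>q. q x) ` C)" for x
        by (auto simp: bdd_below_def)
      have u_le: "u x \<le> q x" if "q \<in> C" for q x
        unfolding u_def by (rule cINF_lower[OF bdd that])
      have u_ge: "l \<le> u x" if "\<And>q. q \<in> C \<Longrightarrow> l \<le> q x" for l x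
        unfolding u_def using False that by (intro cINF_greatest) auto
      have "sublinear u"
      proof (rule sublinearI)
        fix x y
        \<comment> \<open>In a chain, the smaller of \<open>q\<close> and \<open>q'\<close> can be used for both arguments.\<close>
        have "u (x + y) - q x \<le> q' y" if qq: "q \<in> C" "q' \<in> C" for q q'
        proof -
          obtain r where r: "r \<in> C" "r \<le> q" "r \<le> q'" using tot[OF qq] qq by auto
          have "u (x + y) \<le> r x + r y"
            using u_le[OF r(1), of "x + y"] sublinear_add[OF CA(1)[OF r(1)], of x y] by simp
          then show ?thesis using le_funD[OF r(2), of x] le_funD[OF r(3), of y] by simp
        qed
        then have "u (x + y) - q x \<le> u y" if "q \<in> C" for q using that by (intro u_ge) auto
        then have "u (x + y) - u y \<le> u x" by (intro u_ge) (auto simp: algebra_simps)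
        then show "u (x + y) \<le> u x + u y" by simp
      next
        fix t :: real and x assume t: "t > 0"
        have "u (t *\<^sub>R x) / t \<le> u x"
        proof (rule u_ge)
          fix q assume "q \<in> C"
          then show "u (t *\<^sub>R x) / t \<le> q x"
            using u_le[of q "t *\<^sub>R x"] sublinear_scaleR[OF CA(1) t, of q x] t by (simp add: field_simps)
        qed
        then show "u (t *\<^sub>R x) \<le> t * u x" using t by (simp add: field_simps)
      qed
      moreover obtain q where "q \<in> C" using False by blast
      then have "u \<le> p" using u_le[of q] CA(2)[of q] by (meson le_funI order_trans le_funD)
      ultimately show ?thesis using u_le by (auto simp: A_def le_fun_def)
    qed
  qed
  then obtain m where m: "sublinear m" "m \<le> p" and min: "\<And>q. sublinear q \<Longrightarrow> q \<le> m \<Longrightarrow> q = m"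
    unfolding A_def by (smt (verit) mem_Collect_eq order_trans)
  have neg: "m (- x) = - m x" for x
  proof -
    obtain q where "sublinear q" "q \<le> m" "q (- x) \<le> - m x"
      using sublinear_minorant_in_direction[OF m(1)] by blast
    then have "m (- x) \<le> - m x" using min by blast
    then show ?thesis using sublinear_minus[OF m(1), of x] by simp
  qed
  \<comment> \<open>As \<open>m\<close> is odd, superadditivity is subadditivity at the opposite vectors.\<close>
  have add: "m (x + y) = m x + m y" for x y
    using sublinear_add[OF m(1), of x y] sublinear_add[OF m(1), of "- x" "- y"]
      neg[of x] neg[of y] neg[of "x + y"] by simp
  have "m (t *\<^sub>R x) = t * m x" for t x
  proof (cases "t > 0")
    case True
    then show ?thesis by (rule sublinear_scaleR[OF m(1)])
  next
    case False
    then show ?thesis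
      using sublinear_scaleR[OF m(1), of "- t" x] sublinear_0[OF m(1)] neg[of "t *\<^sub>R x"]
      by (cases "t = 0") auto
  qed
  then have "linear m" using add by (intro linearI) auto
  then show ?thesis using m(2) by blast
qed

text \<open>A linear functional below a sublinear minorant of the norm in direction \<open>x\<close> is at most \<open>- norm x\<close>
  at \<open>- x\<close>, hence at least \<open>norm x\<close> at \<open>x\<close>.\<close>

lemma norming_functional:
  fixes x :: "'a::real_normed_vector"
  shows "\<exists>\<phi> :: 'a \<Rightarrow>\<^sub>L real. norm \<phi> \<le> 1 \<and> blinfun_apply \<phi> x = norm x"
proof -
  have "sublinear (norm :: 'a \<Rightarrow> real)"
    by (rule sublinearI) (auto simp: norm_triangle_ineq)
  then obtain q where q: "sublinear q" "q \<le> norm" "q (- x) \<le> - norm x"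
    using sublinear_minorant_in_direction by blast
  then obtain f where f: "linear f" "f \<le> q" using linear_minorant by blast
  interpret f: linear f by fact
  have le: "f y \<le> norm y" for y using le_funD[OF f(2), of y] le_funD[OF q(2), of y] by simp
  have abs: "norm (f y) \<le> 1 * norm y" for y
    using le[of y] le[of "- y"] by (simp add: f.neg)
  have bl: "bounded_linear f"
    using abs by (intro bounded_linear_intro[of f 1]) (auto simp: f.add f.scale)
  have "f x = norm x"
    using le_funD[OF f(2), of "- x"] q(3) le[of x] by (simp add: f.neg)
  moreover have "norm (Blinfun f) \<le> 1"
    using abs by (intro norm_blinfun_bound) (auto simp: bounded_linear_Blinfun_apply[OF bl])
  ultimately show ?thesis using bounded_linear_Blinfun_apply[OF bl] by metis
qed

section \<open>Weak convergence\<close>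

text \<open>The \<open>x i\<close>, seen as functionals \<open>T i\<close> on the dual space, are pointwise bounded, hence uniformly bounded;
  the dual space is complete even where the space itself is not. Norming functionals give
  \<open>norm (x i) \<le> norm (T i)\<close>.\<close>

lemma weakly_convergent_imp_bounded:
  fixes x :: "nat \<Rightarrow> 'a::real_normed_vector"
  assumes "limitin weak_topology x l sequentially"
  shows "bounded (range x)"
proof -
  define T :: "nat \<Rightarrow> ('a \<Rightarrow>\<^sub>L real) \<Rightarrow>\<^sub>L real" where "T i = Blinfun (\<lambda>\<phi>. blinfun_apply \<phi> (x i))" for i
  have T: "blinfun_apply (T i) \<phi> = blinfun_apply \<phi> (x i)" for i \<phi>
    unfolding T_def by (simp add: bounded_linear_Blinfun_apply blinfun.bounded_linear_left)
  have "bounded (range T)"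
    using assms unfolding limitin_weak_topology
    by (intro Banach_Steinhaus) (auto simp: T intro: convergent_imp_bounded)
  then obtain C where C: "\<And>i. norm (T i) \<le> C" by (auto simp: bounded_iff)
  have "norm (x i) \<le> C" for i
  proof -
    obtain \<phi> :: "'a \<Rightarrow>\<^sub>L real" where \<phi>: "norm \<phi> \<le> 1" "blinfun_apply \<phi> (x i) = norm (x i)"
      using norming_functional by blast
    have "norm (x i) = norm (T i \<phi>)" by (simp add: T \<phi>)
    also have "\<dots> \<le> norm (T i) * norm \<phi>" by (rule norm_blinfun)
    also have "\<dots> \<le> C" using mult_mono[OF C[of i] \<phi>(1)] C[of i] by (smt (verit) norm_ge_zero)
    finally show ?thesis .
  qed
  then show ?thesis by (auto simp: bounded_iff)
qed

lemma weakly_convergent_basis_projection: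
  fixes e :: "nat \<Rightarrow> 'a::banach"
  assumes "schauder_basis e" "I \<subseteq> basis_indices TYPE('a)" "limitin weak_topology x l sequentially"
  shows "(\<lambda>i. basis_projection e I (x i)) \<longlonglongrightarrow> basis_projection e I l"
  unfolding basis_projection_def
proof (intro tendsto_sum tendsto_scaleR tendsto_const)
  fix k assume "k \<in> I"
  then have bl: "bounded_linear (\<lambda>x. coord e x k)"
    using assms by (intro coord_bounded_linear) auto
  show "(\<lambda>i. coord e (x i) k) \<longlonglongrightarrow> coord e l k"
    using assms(3)[unfolded limitin_weak_topology, rule_format, of "Blinfun (\<lambda>x. coord e x k)"]
    by (simp add: bounded_linear_Blinfun_apply[OF bl])
qed

lemma weakly_convergent_finitely_many_components:
  fixes e :: "nat \<Rightarrow> 'a::banach"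
  assumes "schauder_basis e" "depends_on_finitely_many_components e U g"
    and "\<And>i. x i \<in> U" "l \<in> U" "limitin weak_topology x l sequentially"
  shows "(\<lambda>i. g (x i)) \<longlonglongrightarrow> g l"
proof -
  obtain I g' where I: "I \<subseteq> basis_indices TYPE('a)"
    and cont: "continuous_on (basis_projection e I ` U) g'"
    and g: "\<And>x. x \<in> U \<Longrightarrow> g x = g' (basis_projection e I x)"
    using assms(2) unfolding depends_on_finitely_many_components_def by blast
  have "(\<lambda>i. g' (basis_projection e I (x i))) \<longlonglongrightarrow> g' (basis_projection e I l)"
    using assms by (intro continuous_on_tendsto_compose[OF cont] 
        weakly_convergent_basis_projection[OF assms(1) I assms(5)]) auto
  then show ?thesis using assms(3,4) by (simp add: g)
qed

text \<open>The component-* property asserts only that some weak* limit exists. Interleaving \<open>\<phi>\<close> with the constant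
  sequence \<open>\<psi>\<close> identifies it: the odd terms have limit \<open>\<psi>\<close>, so the even ones do too.\<close>

lemma weak_star_limit_eq_coordinatewise_limit:
  fixes e :: "nat \<Rightarrow> 'a::banach" and f :: "nat \<Rightarrow> 'a \<Rightarrow>\<^sub>L real"
  assumes "component_star_property e f" "bounded (range \<phi>)"
    and "\<And>j. j \<in> basis_indices TYPE('a \<Rightarrow>\<^sub>L real) \<Longrightarrow> (\<lambda>i. coord f (\<phi> i) j) \<longlonglongrightarrow> coord f \<psi> j"
  shows "limitin weak_star_topology \<phi> \<psi> sequentially"
proof -
  define \<eta> where "\<eta> i = (if even i then \<phi> (i div 2) else \<psi>)" for i
  have "range \<eta> \<subseteq> insert \<psi> (range \<phi>)" by (auto simp: \<eta>_def)
  then have bd: "bounded (range \<eta>)"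
    using assms(2) bounded_subset by (metis bounded_insert)
  have "(\<lambda>i. coord f (\<eta> i) j) \<longlonglongrightarrow> coord f \<psi> j" if "j \<in> basis_indices TYPE('a \<Rightarrow>\<^sub>L real)" for j
  proof -
    have "(\<lambda>i. coord f (\<phi> (i div 2)) j) \<longlonglongrightarrow> coord f \<psi> j"
      by (rule filterlim_compose[OF assms(3)[OF that]]) (rule filterlim_at_top_div_const_nat, simp)
    then show ?thesis
      unfolding \<eta>_def if_distrib[of "\<lambda>y. coord f y j"]
      by (intro filterlim_If tendsto_const) (rule tendsto_mono[OF inf_le1])
  qed
  then have "componentwise_convergent f \<eta>"
    by (auto simp: componentwise_convergent_def convergent_def)
  then obtain \<zeta> where \<zeta>: "\<And>z. (\<lambda>i. \<eta> i z) \<longlonglongrightarrow> \<zeta> z"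
    using assms(1) bd unfolding component_star_property_def limitin_weak_star_topology by blast
  show ?thesis
    unfolding limitin_weak_star_topology
  proof
    fix z
    have "(\<lambda>i. \<eta> (2 * i + 1) z) \<longlonglongrightarrow> \<zeta> z"
      using LIMSEQ_subseq_LIMSEQ[OF \<zeta>, of "\<lambda>i. 2 * i + 1" z] by (simp add: o_def strict_mono_def)
    then have "\<zeta> z = \<psi> z" by (simp add: \<eta>_def LIMSEQ_const_iff)
    moreover have "(\<lambda>i. \<eta> (2 * i) z) \<longlonglongrightarrow> \<zeta> z"
      using LIMSEQ_subseq_LIMSEQ[OF \<zeta>, of "\<lambda>i. 2 * i" z] by (simp add: o_def strict_mono_def)
    ultimately show "(\<lambda>i. \<phi> i z) \<longlonglongrightarrow> \<psi> z" by (simp add: \<eta>_def)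
  qed
qed

theorem proposition5p6:
  fixes e :: "nat \<Rightarrow> 'a::banach"
    and f :: "nat \<Rightarrow> 'a \<Rightarrow>\<^sub>L real"
    and U :: "'a set"
    and h :: "'a \<Rightarrow> 'a \<Rightarrow>\<^sub>L real"
  assumes "component_star_property e f"
    and "U \<noteq> {}"
    and "\<And>x :: nat \<Rightarrow> 'a. range x \<subseteq> U \<Longrightarrow> bounded (range x) \<Longrightarrow> bounded (range (\<lambda>i. h (x i)))"
    and "\<And>j. j \<in> basis_indices TYPE('a \<Rightarrow>\<^sub>L real) \<Longrightarrow>
           depends_on_finitely_many_components e U (\<lambda>x. coord f (h x) j)"
  shows "weak_to_weak_star_seq_continuous_on U h"
  unfolding weak_to_weak_star_seq_continuous_on_def limitin_weak_star_topology[symmetric]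
proof (intro allI impI, elim conjE)
  fix x :: "nat \<Rightarrow> 'a" and l
  assume x: "\<forall>i. x i \<in> U" "l \<in> U" and lim: "limitin weak_topology x l sequentially"
  have e: "schauder_basis e" using assms(1) by (simp add: component_star_property_def)
  have "bounded (range (\<lambda>i. h (x i)))"
    using x by (intro assms(3) weakly_convergent_imp_bounded[OF lim]) auto
  moreover have "(\<lambda>i. coord f (h (x i)) j) \<longlonglongrightarrow> coord f (h l) j"
    if "j \<in> basis_indices TYPE('a \<Rightarrow>\<^sub>L real)" for j
    using weakly_convergent_finitely_many_components[OF e assms(4)[OF that] _ x(2) lim] x(1) by blast
  ultimately show "limitin weak_star_topology (\<lambda>i. h (x i)) (h l) sequentially"
    by (rule weak_star_limit_eq_coordinatewise_limit[OF assms(1)])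
qed

end
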